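(* For any finite set $\Omega$ with at least $5$ elements, the Johnson graph $J(\Omega,2)$ is not triply transitive.
   Context: $J(\Omega,2)$ (the triangular graph) has as vertices the $2$-element subsets of $\Omega$, two being adjacent iff they share exactly one element. For a strongly regular graph $\Gamma=(V,E)$: $A_0=I$, $A_1$ its adjacency matrix, $A_2=J-I-A_1$; for a vertex $\omega$, $E^*_{i,\omega}$ ($i=0,1,2$) is the diagonal matrix whose diagonal is the $\omega$-row of $A_i$; $T_\omega$ is the subalgebra of $M_{|V|}(\mathbb C)$ generated by $A_0,A_1,A_2,E^*_{0,\omega},E^*_{1,\omega},E^*_{2,\omega}$; $T_{0,\omega}$ is the span of all $E^*_{i,\omega}A_jE^*_{k,\omega}$; $\tilde T_\omega$ is the algebra of complex matrices commuting with the permutation matrices of the stabilizer $G_\omega$ in $G=\mathrm{Aut}(\Gamma)$. $\Gamma$ is triply transitive if $G$ is transitive and $T_{0,\omega}=T_\omega=\tilde T_\omega$ for some (equivalently every) vertex $\omega$. *)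

theory Defs
  imports Complex_Main "HOL-Library.Function_Algebras" "HOL-Combinatorics.Permutations"
begin

text \<open>
  A graph is given by its vertex set \<open>V\<close> and its set \<open>E\<close> of edges, an edge being a two-element
  set of vertices.  An element of \<open>M\<^sub>V(\<complex>)\<close> is a function \<open>'v \<Rightarrow> 'v \<Rightarrow> complex\<close> that vanishes
  outside \<open>V \<times> V\<close>; so equality of functions is equality of matrices, and addition and
  subtraction are the pointwise operations.
\<close>

type_synonym 'v cmat = "'v \<Rightarrow> 'v \<Rightarrow> complex"

definition simple_graph :: "'v set \<Rightarrow> 'v set set \<Rightarrow> bool" where
  "simple_graph V E \<longleftrightarrow> finite V \<and> (\<forall>e\<in>E. e \<subseteq> V \<and> card e = 2)"

definition nbrs :: "'v set \<Rightarrow> 'v set set \<Rightarrow> 'v \<Rightarrow> 'v set" where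
  "nbrs V E u = {v\<in>V. {u, v} \<in> E}"

text \<open>The condition \<open>0 < k < n - 1\<close> excludes edgeless and complete graphs.\<close>

definition strongly_regular ::
    "'v set \<Rightarrow> 'v set set \<Rightarrow> nat \<Rightarrow> nat \<Rightarrow> nat \<Rightarrow> nat \<Rightarrow> bool" where
  "strongly_regular V E n k l m \<longleftrightarrow>
     simple_graph V E \<and> card V = n \<and> 0 < k \<and> k < n - 1 \<and>
     (\<forall>u\<in>V. card (nbrs V E u) = k) \<and>
     (\<forall>u\<in>V. \<forall>v\<in>V. {u, v} \<in> E \<longrightarrow> card (nbrs V E u \<inter> nbrs V E v) = l) \<and>
     (\<forall>u\<in>V. \<forall>v\<in>V. u \<noteq> v \<and> {u, v} \<notin> E \<longrightarrow> card (nbrs V E u \<inter> nbrs V E v) = m)"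

definition mat_carrier :: "'v set \<Rightarrow> 'v cmat set" where
  "mat_carrier V = {M. \<forall>u v. u \<notin> V \<or> v \<notin> V \<longrightarrow> M u v = 0}"

definition mat_scale :: "complex \<Rightarrow> 'v cmat \<Rightarrow> 'v cmat" where
  "mat_scale c M = (\<lambda>u v. c * M u v)"

definition mat_mult :: "'v set \<Rightarrow> 'v cmat \<Rightarrow> 'v cmat \<Rightarrow> 'v cmat" where
  "mat_mult V M N = (\<lambda>u v. \<Sum>w\<in>V. M u w * N w v)"

definition mat_id :: "'v set \<Rightarrow> 'v cmat" where
  "mat_id V = (\<lambda>u v. if u \<in> V \<and> u = v then 1 else 0)"

definition mat_ones :: "'v set \<Rightarrow> 'v cmat" where
  "mat_ones V = (\<lambda>u v. if u \<in> V \<and> v \<in> V then 1 else 0)"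

global_interpretation cmat: vector_space "mat_scale :: complex \<Rightarrow> 'v cmat \<Rightarrow> 'v cmat"
  by unfold_locales (auto simp: mat_scale_def fun_eq_iff algebra_simps)

definition mat_subalgebra :: "'v set \<Rightarrow> 'v cmat set \<Rightarrow> bool" where
  "mat_subalgebra V B \<longleftrightarrow>
     B \<subseteq> mat_carrier V \<and> cmat.subspace B \<and> mat_id V \<in> B \<and>
     (\<forall>M\<in>B. \<forall>N\<in>B. mat_mult V M N \<in> B)"

definition adj_mat :: "'v set \<Rightarrow> 'v set set \<Rightarrow> 'v cmat" where
  "adj_mat V E = (\<lambda>u v. if u \<in> V \<and> v \<in> V \<and> {u, v} \<in> E then 1 else 0)"

text \<open>The matrices \<open>A\<^sub>0, A\<^sub>1, A\<^sub>2\<close>; only the indices \<open>i \<in> {0,1,2}\<close> are used.\<close>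

definition rel_mat :: "'v set \<Rightarrow> 'v set set \<Rightarrow> nat \<Rightarrow> 'v cmat" where
  "rel_mat V E i =
     (if i = 0 then mat_id V
      else if i = 1 then adj_mat V E
      else mat_ones V - mat_id V - adj_mat V E)"

definition dual_idem :: "'v set \<Rightarrow> 'v set set \<Rightarrow> 'v \<Rightarrow> nat \<Rightarrow> 'v cmat" where
  "dual_idem V E \<omega> i = (\<lambda>u v. if u = v then rel_mat V E i \<omega> u else 0)"

definition terwilliger_alg :: "'v set \<Rightarrow> 'v set set \<Rightarrow> 'v \<Rightarrow> 'v cmat set" where
  "terwilliger_alg V E \<omega> =
     mat_subalgebra V hull (rel_mat V E ` {0,1,2} \<union> dual_idem V E \<omega> ` {0,1,2})"

definition terwilliger_T0 :: "'v set \<Rightarrow> 'v set set \<Rightarrow> 'v \<Rightarrow> 'v cmat set" where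
  "terwilliger_T0 V E \<omega> =
     cmat.span {mat_mult V (mat_mult V (dual_idem V E \<omega> i) (rel_mat V E j)) (dual_idem V E \<omega> k)
       | i j k. i \<in> {0,1,2} \<and> j \<in> {0,1,2} \<and> k \<in> {0,1,2}}"

definition graph_aut :: "'v set \<Rightarrow> 'v set set \<Rightarrow> ('v \<Rightarrow> 'v) set" where
  "graph_aut V E = {g. g permutes V \<and> (\<forall>u\<in>V. \<forall>v\<in>V. {g u, g v} \<in> E \<longleftrightarrow> {u, v} \<in> E)}"

definition aut_stabilizer :: "'v set \<Rightarrow> 'v set set \<Rightarrow> 'v \<Rightarrow> ('v \<Rightarrow> 'v) set" where
  "aut_stabilizer V E \<omega> = {g \<in> graph_aut V E. g \<omega> = \<omega>}"

definition perm_mat :: "'v set \<Rightarrow> ('v \<Rightarrow> 'v) \<Rightarrow> 'v cmat" where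
  "perm_mat V g = (\<lambda>u v. if v \<in> V \<and> u = g v then 1 else 0)"

definition centralizer_alg :: "'v set \<Rightarrow> 'v set set \<Rightarrow> 'v \<Rightarrow> 'v cmat set" where
  "centralizer_alg V E \<omega> =
     {M \<in> mat_carrier V. \<forall>g \<in> aut_stabilizer V E \<omega>.
        mat_mult V M (perm_mat V g) = mat_mult V (perm_mat V g) M}"

definition vertex_transitive :: "'v set \<Rightarrow> 'v set set \<Rightarrow> bool" where
  "vertex_transitive V E \<longleftrightarrow> (\<forall>u\<in>V. \<forall>v\<in>V. \<exists>g\<in>graph_aut V E. g u = v)"

text \<open>
  Intended for strongly regular graphs, but strong regularity is deliberately not a conjunct,
  so that a graph cannot fail to be triply transitive merely by not being strongly regular.
\<close>

definition triply_transitive :: "'v set \<Rightarrow> 'v set set \<Rightarrow> bool" where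
  "triply_transitive V E \<longleftrightarrow>
     vertex_transitive V E \<and>
     (\<exists>\<omega>\<in>V. terwilliger_T0 V E \<omega> = terwilliger_alg V E \<omega> \<and>
            terwilliger_alg V E \<omega> = centralizer_alg V E \<omega>)"

definition johnson2_verts :: "'a set \<Rightarrow> 'a set set" where
  "johnson2_verts \<Omega> = {u. u \<subseteq> \<Omega> \<and> card u = 2}"

definition johnson2_edges :: "'a set \<Rightarrow> 'a set set set" where
  "johnson2_edges \<Omega> =
     {{u, v} | u v. u \<in> johnson2_verts \<Omega> \<and> v \<in> johnson2_verts \<Omega> \<and> card (u \<inter> v) = 1}"

lemma johnson2_edge_iff:
  "{u, v} \<in> johnson2_edges \<Omega> \<longleftrightarrow>
     u \<in> johnson2_verts \<Omega> \<and> v \<in> johnson2_verts \<Omega> \<and> card (u \<inter> v) = 1"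
  unfolding johnson2_edges_def by (auto simp: doubleton_eq_iff Int_commute)

lemma johnson2_nbrs:
  assumes "a \<in> \<Omega>" "b \<in> \<Omega>" "a \<noteq> b"
  shows "nbrs (johnson2_verts \<Omega>) (johnson2_edges \<Omega>) {a, b} =
    (\<lambda>x. {a, x}) ` (\<Omega> - {a, b}) \<union> (\<lambda>x. {b, x}) ` (\<Omega> - {a, b})" (is "?L = ?R")
proof
  show "?L \<subseteq> ?R"
  proof
    fix v assume "v \<in> ?L"
    then have v: "v \<subseteq> \<Omega>" "card v = 2" "card ({a, b} \<inter> v) = 1"
      by (auto simp: nbrs_def johnson2_edge_iff johnson2_verts_def)
    then obtain c d where "v = {c, d}" "c \<noteq> d" by (auto simp: card_2_iff)
    with v assms show "v \<in> ?R"
      by (cases "c = a"; cases "c = b"; cases "d = a"; cases "d = b")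
         (auto simp: insert_commute)
  qed
  show "?R \<subseteq> ?L"
    using assms
    by (auto simp: nbrs_def johnson2_edge_iff johnson2_verts_def card_2_iff Int_insert_left)
qed

lemma johnson2_strongly_regular:
  assumes "finite \<Omega>" "card \<Omega> \<ge> 5"
  shows "strongly_regular (johnson2_verts \<Omega>) (johnson2_edges \<Omega>)
    (card \<Omega> choose 2) (2 * (card \<Omega> - 2)) (card \<Omega> - 2) 4"
proof -
  let ?V = "johnson2_verts \<Omega>" and ?E = "johnson2_edges \<Omega>"
  have fin: "finite ?V"
    unfolding johnson2_verts_def using assms by simp
  have sg: "simple_graph ?V ?E"
    unfolding simple_graph_def
  proof (intro conjI ballI fin)
    fix e assume "e \<in> ?E"
    then obtain u v where e: "e = {u, v}" "u \<in> ?V" "v \<in> ?V" "card (u \<inter> v) = 1"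
      by (auto simp: johnson2_edges_def)
    then show "e \<subseteq> ?V" by simp
    have "u \<noteq> v" using e by (auto simp: johnson2_verts_def)
    then show "card e = 2" using e by simp
  qed
  have cV: "card ?V = card \<Omega> choose 2"
    unfolding johnson2_verts_def using n_subsets[OF assms(1)] by simp
  have inj: "inj_on (\<lambda>x. {a, x}) B" for a :: 'a and B
    by (auto simp: inj_on_def doubleton_eq_iff)
  have k: "card (nbrs ?V ?E u) = 2 * (card \<Omega> - 2)" if "u \<in> ?V" for u
  proof -
    from that obtain a b where ab: "u = {a, b}" "a \<noteq> b" "a \<in> \<Omega>" "b \<in> \<Omega>"
      by (auto simp: johnson2_verts_def card_2_iff)
    have "card (\<Omega> - {a, b}) = card \<Omega> - 2"
      using ab assms by (subst card_Diff_subset) auto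
    then show ?thesis
      unfolding ab(1) johnson2_nbrs[OF ab(3,4,2)]
      using ab assms
      by (subst card_Un_disjoint) (auto simp: card_image[OF inj] doubleton_eq_iff)
  qed
  have l: "card (nbrs ?V ?E u \<inter> nbrs ?V ?E v) = card \<Omega> - 2"
    if "{u, v} \<in> ?E" for u v
  proof -
    from that have uv: "u \<in> ?V" "v \<in> ?V" "card (u \<inter> v) = 1"
      by (auto simp: johnson2_edge_iff)
    from uv(1) obtain a b where ab: "u = {a, b}" "a \<noteq> b" "a \<in> \<Omega>" "b \<in> \<Omega>"
      by (auto simp: johnson2_verts_def card_2_iff)
    from that ab have "v \<in> nbrs ?V ?E {a, b}" by (auto simp: nbrs_def johnson2_edge_iff)
    then obtain p q r where p: "u = {p, q}" "v = {p, r}" "p \<noteq> q" "p \<noteq> r" "q \<noteq> r"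
        "p \<in> \<Omega>" "q \<in> \<Omega>" "r \<in> \<Omega>"
      unfolding johnson2_nbrs[OF ab(3,4,2)] using ab by (auto simp: insert_commute)
    have "nbrs ?V ?E u \<inter> nbrs ?V ?E v =
        insert {q, r} ((\<lambda>x. {p, x}) ` (\<Omega> - {p, q, r}))"
      unfolding p(1,2) johnson2_nbrs[OF p(6,7,3)] johnson2_nbrs[OF p(6,8,4)]
      using p by (auto simp: doubleton_eq_iff image_iff)
    moreover have "card (\<Omega> - {p, q, r}) = card \<Omega> - 3"
      using p assms by (subst card_Diff_subset) auto
    moreover have "{q, r} \<notin> (\<lambda>x. {p, x}) ` (\<Omega> - {p, q, r})"
      using p by (auto simp: doubleton_eq_iff)
    ultimately show ?thesis
      using assms by (simp add: card_image[OF inj])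
  qed
  have m: "card (nbrs ?V ?E u \<inter> nbrs ?V ?E v) = 4"
    if "u \<in> ?V" "v \<in> ?V" "u \<noteq> v" "{u, v} \<notin> ?E" for u v
  proof -
    from that(1) obtain a b where ab: "u = {a, b}" "a \<noteq> b" "a \<in> \<Omega>" "b \<in> \<Omega>"
      by (auto simp: johnson2_verts_def card_2_iff)
    from that(2) obtain c d where cd: "v = {c, d}" "c \<noteq> d" "c \<in> \<Omega>" "d \<in> \<Omega>"
      by (auto simp: johnson2_verts_def card_2_iff)
    have "card (u \<inter> v) \<noteq> 1" using that by (auto simp: johnson2_edge_iff)
    then have ne: "a \<noteq> c" "a \<noteq> d" "b \<noteq> c" "b \<noteq> d"
      using ab cd that(3) by (auto simp: Int_insert_left insert_commute split: if_splits)
    have "nbrs ?V ?E u \<inter> nbrs ?V ?E v = {{a, c}, {a, d}, {b, c}, {b, d}}" (is "?L = ?R")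
    proof
      show "?L \<subseteq> ?R"
      proof
        fix w assume "w \<in> ?L"
        then have w: "w \<in> nbrs ?V ?E {a, b}" "w \<in> nbrs ?V ?E {c, d}"
          unfolding ab(1) cd(1) by simp_all
        from w(2) obtain y where y: "w = {c, y} \<or> w = {d, y}" "y \<noteq> c" "y \<noteq> d"
          unfolding johnson2_nbrs[OF cd(3,4,2)] by auto
        from w(1) have "a \<in> w \<or> b \<in> w"
          unfolding johnson2_nbrs[OF ab(3,4,2)] by auto
        with y(1) ne have "y = a \<or> y = b" by auto
        with y(1) show "w \<in> ?R" by (auto simp: insert_commute)
      qed
      have "{a, c} \<in> nbrs ?V ?E {a, b}" "{a, d} \<in> nbrs ?V ?E {a, b}"
           "{b, c} \<in> nbrs ?V ?E {a, b}" "{b, d} \<in> nbrs ?V ?E {a, b}"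
        unfolding johnson2_nbrs[OF ab(3,4,2)] using cd ne by blast+
      moreover have "{c, a} \<in> nbrs ?V ?E {c, d}" "{d, a} \<in> nbrs ?V ?E {c, d}"
           "{c, b} \<in> nbrs ?V ?E {c, d}" "{d, b} \<in> nbrs ?V ?E {c, d}"
        unfolding johnson2_nbrs[OF cd(3,4,2)] using ab ne by blast+
      ultimately show "?R \<subseteq> ?L"
        unfolding ab(1) cd(1) by (simp add: insert_commute)
    qed
    then show ?thesis using ab cd ne by (simp add: doubleton_eq_iff)
  qed
  have lt: "2 * (card \<Omega> - 2) < (card \<Omega> choose 2) - 1"
  proof -
    obtain t where t: "card \<Omega> = t + 5" using assms(2) by (metis add.commute le_Suc_ex)
    have "(t + 5) * (t + 4) \<ge> 2 * (2 * t + 8)"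
      by (simp add: algebra_simps)
    then have "(t + 5) * (t + 4) div 2 \<ge> 2 * t + 8"
      using div_le_mono[of "2 * (2 * t + 8)" "(t + 5) * (t + 4)" 2] by simp
    moreover have "(t + 5) choose 2 = (t + 5) * (t + 4) div 2"
      by (simp add: choose_two add.commute[of 4])
    ultimately show ?thesis unfolding t by linarith
  qed
  show ?thesis
    unfolding strongly_regular_def
    using sg cV lt assms(2) k l m by auto
qed

end

theory Submission imports Defs begin

text \<open>
  Every matrix in the span \<open>T\<^sub>0\<close> has entries that depend only on the relations between \<open>\<omega>\<close>,
  the row and the column.  If \<open>T\<^sub>0\<close> is closed under multiplication, squaring
  \<open>E\<^sup>*\<^sub>1 A\<^sub>1 E\<^sup>*\<^sub>1\<close> shows that all triangles \<open>\<omega>, u, v\<close> through \<open>\<omega>\<close> have the same number of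
  common neighbours.  In the triangular graph this fails: the triangle \<open>{a,b}, {a,x}, {a,y}\<close>
  has the common neighbour \<open>{a,z}\<close>, but \<open>{a,b}, {a,x}, {b,x}\<close> has none.
\<close>

text \<open>Multiplication by a diagonal matrix on the left scales rows, on the right
  columns.\<close>

lemma dual_rel_dual_entry:
  assumes "finite V" "u \<in> V" "v \<in> V"
  shows "mat_mult V (mat_mult V (dual_idem V E \<omega> i) (rel_mat V E j)) (dual_idem V E \<omega> k) u v =
    rel_mat V E i \<omega> u * rel_mat V E j u v * rel_mat V E k \<omega> v"
proof -
  have row: "mat_mult V (dual_idem V E \<omega> i) N u w = rel_mat V E i \<omega> u * N u w" for N w
    using assms by (simp add: mat_mult_def dual_idem_def if_distrib[of "\<lambda>x. x * _"] cong: if_cong)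
  have "mat_mult V M (dual_idem V E \<omega> k) u v = M u v * rel_mat V E k \<omega> v" for M
    using assms by (simp add: mat_mult_def dual_idem_def if_distrib[of "\<lambda>x. _ * x"] cong: if_cong)
  then show ?thesis by (simp add: row)
qed

lemma edge_neq:
  assumes "simple_graph V E" "{u, v} \<in> E"
  shows "u \<noteq> v"
  using assms by (force simp: simple_graph_def)

lemma rel_mat_edge:
  assumes "simple_graph V E" "{u, v} \<in> E"
  shows "rel_mat V E j u v = (if j = 1 then 1 else 0)"
proof -
  have "u \<in> V" "v \<in> V" "u \<noteq> v"
    using assms edge_neq[OF assms] by (auto simp: simple_graph_def)
  then show ?thesis
    using assms(2) by (simp add: rel_mat_def mat_id_def mat_ones_def adj_mat_def)
qed

text \<open>On a spanning matrix the entry is a product of three relation entries, each taken along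
  an edge and hence determined by the indices alone; equality of two entries is linear, so it passes
  to the span.\<close>

lemma terwilliger_T0_triangle_entries:
  assumes "simple_graph V E" "M \<in> terwilliger_T0 V E \<omega>"
    and "{\<omega>, u} \<in> E" "{\<omega>, v} \<in> E" "{\<omega>, w} \<in> E" "{u, v} \<in> E" "{u, w} \<in> E"
  shows "M u v = M u w"
  using assms(2) unfolding terwilliger_T0_def
proof (induction rule: cmat.span_induct_alt)
  case base
  show ?case by (simp add: zero_fun_def)
next
  case (step c N M)
  have "finite V" "u \<in> V" "v \<in> V" "w \<in> V"
    using assms(1) assms(3-5) by (auto simp: simple_graph_def)
  then have "N u v = N u w"
    using step.hyps assms by (auto simp: dual_rel_dual_entry rel_mat_edge)
  with step.IH show ?case by (simp add: mat_scale_def)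
qed

text \<open>The hull is the intersection of all subalgebras containing the generators, and each of
  these is closed under products.\<close>

lemma mat_mult_in_terwilliger_alg:
  assumes "M \<in> terwilliger_alg V E \<omega>" "N \<in> terwilliger_alg V E \<omega>"
  shows "mat_mult V M N \<in> terwilliger_alg V E \<omega>"
  using assms unfolding terwilliger_alg_def hull_def by (auto simp: mat_subalgebra_def)

lemma common_nbrs_triangle_eq:
  assumes sg: "simple_graph V E"
    and T: "terwilliger_T0 V E \<omega> = terwilliger_alg V E \<omega>"
    and e: "{\<omega>, u} \<in> E" "{\<omega>, v} \<in> E" "{\<omega>, w} \<in> E" "{u, v} \<in> E" "{u, w} \<in> E"
  shows "card (nbrs V E \<omega> \<inter> nbrs V E u \<inter> nbrs V E v) =
    card (nbrs V E \<omega> \<inter> nbrs V E u \<inter> nbrs V E w)"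
proof -
  have V: "finite V" "\<omega> \<in> V" "u \<in> V" "v \<in> V" "w \<in> V"
    using sg e(1-3) by (auto simp: simple_graph_def)
  \<comment> \<open>On \<open>V\<close>, \<open>B\<close> is the adjacency matrix of the subgraph
    induced on the neighbours of \<open>\<omega>\<close>, so its square counts paths of length two
    inside that subgraph.\<close>
  define B where
    "B = mat_mult V (mat_mult V (dual_idem V E \<omega> 1) (rel_mat V E 1)) (dual_idem V E \<omega> 1)"
  have gens: "rel_mat V E 1 \<in> terwilliger_alg V E \<omega>" "dual_idem V E \<omega> 1 \<in> terwilliger_alg V E \<omega>"
    unfolding terwilliger_alg_def by (auto intro!: hull_inc)
  \<comment> \<open>The hypothesis \<open>T\<close> enters here: it makes the span closed under
    products.\<close>
  have BB: "mat_mult V B B \<in> terwilliger_T0 V E \<omega>"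
    unfolding T B_def by (intro mat_mult_in_terwilliger_alg gens)
  have B: "B p q = (if {\<omega>, p} \<in> E \<and> {p, q} \<in> E \<and> {\<omega>, q} \<in> E then 1 else 0)"
    if "p \<in> V" "q \<in> V" for p q
    unfolding B_def dual_rel_dual_entry[OF V(1) that]
    using that V(2) by (simp add: rel_mat_def adj_mat_def)
  have entry: "mat_mult V B B u q = of_nat (card (nbrs V E \<omega> \<inter> nbrs V E u \<inter> nbrs V E q))"
    if q: "q \<in> V" "{\<omega>, q} \<in> E" for q
  proof -
    have "mat_mult V B B u q =
        (\<Sum>z\<in>V. if z \<in> nbrs V E \<omega> \<inter> nbrs V E u \<inter> nbrs V E q then 1 else 0)"
      unfolding mat_mult_def
      using V q e(1) by (intro sum.cong refl) (auto simp: B nbrs_def insert_commute)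
    also have "\<dots> = of_nat (card (V \<inter> (nbrs V E \<omega> \<inter> nbrs V E u \<inter> nbrs V E q)))"
      using V(1) by (simp add: sum.If_cases Int_def)
    also have "V \<inter> (nbrs V E \<omega> \<inter> nbrs V E u \<inter> nbrs V E q) =
        nbrs V E \<omega> \<inter> nbrs V E u \<inter> nbrs V E q"
      by (auto simp: nbrs_def)
    finally show ?thesis .
  qed
  from terwilliger_T0_triangle_entries[OF sg BB e] show ?thesis
    by (simp add: entry V e)
qed

theorem theorem6p1:
  fixes \<Omega> :: "'a set"
  assumes "finite \<Omega>" and "card \<Omega> \<ge> 5"
  shows "\<not> triply_transitive (johnson2_verts \<Omega>) (johnson2_edges \<Omega>)"
proof
  let ?V = "johnson2_verts \<Omega>" and ?E = "johnson2_edges \<Omega>"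
  assume "triply_transitive ?V ?E"
  then obtain \<omega> where \<omega>: "\<omega> \<in> ?V" "terwilliger_T0 ?V ?E \<omega> = terwilliger_alg ?V ?E \<omega>"
    unfolding triply_transitive_def by blast
  have sg: "simple_graph ?V ?E"
    using johnson2_strongly_regular[OF assms] by (simp add: strongly_regular_def)
  from \<omega>(1) obtain a b where ab: "\<omega> = {a, b}" "a \<noteq> b" "a \<in> \<Omega>" "b \<in> \<Omega>"
    by (auto simp: johnson2_verts_def card_2_iff)
  \<comment> \<open>Five points leave three outside \<open>\<omega>\<close>: \<open>x\<close> and
    \<open>y\<close> form the two triangles, \<open>z\<close> gives the common neighbour of the
    first.\<close>
  have "card (\<Omega> - {a, b}) \<ge> 3"
    using ab assms by (subst card_Diff_subset) auto
  then obtain S where "S \<subseteq> \<Omega> - {a, b}" "card S = 3"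
    by (meson obtain_subset_with_card_n)
  then obtain x y z where xyz: "x \<in> \<Omega>" "y \<in> \<Omega>" "z \<in> \<Omega>" "x \<noteq> y" "x \<noteq> z" "y \<noteq> z"
      "x \<noteq> a" "x \<noteq> b" "y \<noteq> a" "y \<noteq> b" "z \<noteq> a" "z \<noteq> b"
    by (auto simp: card_3_iff)
  have edge: "{{p, q}, {p, r}} \<in> ?E"
    if "p \<in> \<Omega>" "q \<in> \<Omega>" "r \<in> \<Omega>" "p \<noteq> q" "p \<noteq> r" "q \<noteq> r" for p q r
    using that by (auto simp: johnson2_edge_iff johnson2_verts_def Int_insert_left)
  let ?N = "\<lambda>v. nbrs ?V ?E \<omega> \<inter> nbrs ?V ?E {a, x} \<inter> nbrs ?V ?E v"
  have "{{a, b}, {b, x}} \<in> ?E" "{{a, x}, {b, x}} \<in> ?E"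
    using edge[of b a x] edge[of x a b] ab xyz by (simp_all add: insert_commute)
  then have "card (?N {a, y}) = card (?N {b, x})"
    using ab xyz by (intro common_nbrs_triangle_eq[OF sg \<omega>(2)]) (simp_all add: edge)
  \<comment> \<open>A pair meeting all of \<open>{a, b}\<close>, \<open>{a, x}\<close>,
    \<open>{b, x}\<close> contains two of \<open>a\<close>, \<open>b\<close>, \<open>x\<close>, so
    it is one of these three pairs, and no vertex is adjacent to itself.\<close>
  moreover have "v \<notin> ?N {b, x}" for v
  proof
    assume "v \<in> ?N {b, x}"
    then have v: "v \<in> nbrs ?V ?E {a, b}" "v \<in> nbrs ?V ?E {a, x}" "v \<in> nbrs ?V ?E {b, x}"
      unfolding ab(1) by simp_all
    then have "v \<noteq> {a, x}" "v \<noteq> {b, x}"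
      using edge_neq[OF sg, of "{a, x}" v] edge_neq[OF sg, of "{b, x}" v]
      by (simp_all only: nbrs_def mem_Collect_eq) blast+
    moreover from v(1) obtain t where "v = {a, t} \<or> v = {b, t}" "t \<noteq> a" "t \<noteq> b"
      unfolding johnson2_nbrs[OF ab(3,4,2)] by blast
    moreover from v(2,3) have "v \<inter> {a, x} \<noteq> {}" "v \<inter> {b, x} \<noteq> {}"
      by (auto simp only: nbrs_def mem_Collect_eq johnson2_edge_iff Int_commute card.empty)
    ultimately show False using ab(2) xyz(7,8) by auto
  qed
  then have "?N {b, x} = {}" by blast
  ultimately have "card (?N {a, y}) = 0" by (simp only: card.empty)
  moreover have "finite (?N {a, y})"
    using sg by (simp add: simple_graph_def nbrs_def)
  \<comment> \<open>\<open>{a, z}\<close> shares exactly \<open>a\<close> with each of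
    \<open>{a, b}\<close>, \<open>{a, x}\<close>, \<open>{a, y}\<close>.\<close>
  moreover have "{a, z} \<in> ?N {a, y}"
    using ab xyz by (auto simp: nbrs_def edge johnson2_verts_def)
  ultimately show False by (simp only: card_0_eq empty_iff)
qed

end
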